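(* Let $\{A(t)\}_{t\ge0}$ be a continuous time chain of $N\times N$ matrices. Then $\mathbf{rank}(A)$ is greater than or equal to the number of connected components of the infinite flow graph associated with $\{A(t)\}$.
   Context: Let $\mathcal V=\{1,\dots,N\}$. A continuous time chain $\{A(t)\}_{t\ge0}$ is a family of real $N\times N$ matrices $A(t)=(a_{ij}(t))$ with zero row sums and non-negative off-diagonal entries, whose entries are measurable and locally integrable functions of $t\in[0,\infty)$. Let $\Phi(t,\tau)$, $t\ge\tau\ge0$, be the state transition matrix of $\dot x(t)=A(t)x(t)$, so $x(t)=\Phi(t,\tau)x(\tau)$; it is invertible and row-stochastic. Rank: for $\tau\ge0$ let $\mathbf{null}_\tau(A)=\{v\in\mathbb R^N : \lim_{t\to\infty}\Phi(t,\tau)v=\mathbf 0_N\}$. This is a vector space whose dimension does not depend on $\tau$; this dimension is $\mathbf{nullity}(A)$, and $\mathbf{rank}(A)=N-\mathbf{nullity}(A)$. Infinite flow graph: the undirected graph $\mathcal H_2(\mathcal V,\mathcal E_2)$ in which distinct $i,j\in\mathcal V$ are linked if and only if $\int_0^\infty (a_{ij}(t)+a_{ji}(t))\,dt=\infty$. *)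

theory Defs
  imports "HOL-Analysis.Analysis"
begin

text \<open>The vertex set \<open>{1,\<dots>,N}\<close> is the arbitrary finite index type \<open>'n\<close>, so \<open>N = CARD('n)\<close>.
  Only the values \<open>A t\<close> with \<open>t \<ge> 0\<close> are ever used.\<close>

text \<open>Lebesgue integrability on every \<open>{0..T}\<close> includes Lebesgue measurability on \<open>[0,\<infinity>)\<close>.\<close>

definition continuous_time_chain :: "(real \<Rightarrow> real^'n^'n) \<Rightarrow> bool" where
  "continuous_time_chain A \<longleftrightarrow>
     (\<forall>t\<ge>0. \<forall>i. (\<Sum>j\<in>UNIV. A t $ i $ j) = 0) \<and>
     (\<forall>t\<ge>0. \<forall>i j. i \<noteq> j \<longrightarrow> 0 \<le> A t $ i $ j) \<and>
     (\<forall>i j. \<forall>T\<ge>0. (\<lambda>t. A t $ i $ j) absolutely_integrable_on {0..T})"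

text \<open>As the entries of \<open>A\<close> are only locally integrable, solutions of \<open>x' = A x\<close> on \<open>[\<tau>,\<infinity>)\<close>
  are meant in the sense of Caratheodory, i.e. they satisfy
  \<open>x(t) = x(\<tau>) + \<integral>\<^sub>\<tau>\<^sup>t A(s) x(s) ds\<close> for all \<open>t \<ge> \<tau>\<close>.\<close>

definition is_solution :: "(real \<Rightarrow> real^'n^'n) \<Rightarrow> real \<Rightarrow> (real \<Rightarrow> real^'n) \<Rightarrow> bool" where
  "is_solution A \<tau> x \<longleftrightarrow>
     continuous_on {\<tau>..} x \<and>
     (\<forall>t\<ge>\<tau>. ((\<lambda>s. A s *v x s) has_integral (x t - x \<tau>)) {\<tau>..t})"

text \<open>For a chain \<open>A\<close> and \<open>t \<ge> \<tau> \<ge> 0\<close> there is exactly one such matrix, because every initial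
  value at \<open>\<tau>\<close> has exactly one solution and that solution depends linearly on it.\<close>

definition state_transition :: "(real \<Rightarrow> real^'n^'n) \<Rightarrow> real \<Rightarrow> real \<Rightarrow> real^'n^'n" where
  "state_transition A t \<tau> = (THE M. \<forall>x. is_solution A \<tau> x \<longrightarrow> x t = M *v x \<tau>)"

definition chain_null :: "(real \<Rightarrow> real^'n^'n) \<Rightarrow> real \<Rightarrow> (real^'n) set" where
  "chain_null A \<tau> = {v. ((\<lambda>t. state_transition A t \<tau> *v v) \<longlongrightarrow> 0) at_top}"

text \<open>The dimension of \<open>chain_null A \<tau>\<close> is the same for all \<open>\<tau> \<ge> 0\<close>; we take \<open>\<tau> = 0\<close>.\<close>

definition chain_nullity :: "(real \<Rightarrow> real^'n^'n) \<Rightarrow> nat" where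
  "chain_nullity A = dim (chain_null A 0)"

definition chain_rank :: "(real \<Rightarrow> real^'n^'n) \<Rightarrow> nat" where
  "chain_rank A = CARD('n) - chain_nullity A"

text \<open>The edges as a symmetric irreflexive relation. The integrand is non-negative off the diagonal,
  so \<open>ennreal\<close> truncates nothing.\<close>

definition infinite_flow_edges :: "(real \<Rightarrow> real^'n^'n) \<Rightarrow> ('n \<times> 'n) set" where
  "infinite_flow_edges A =
     {(i, j). i \<noteq> j \<and>
        (\<integral>\<^sup>+t\<in>{0..}. ennreal (A t $ i $ j + A t $ j $ i) \<partial>lebesgue) = \<infinity>}"

text \<open>Vertex sets of the connected components of an undirected graph on all of \<open>'n\<close>, given by its
  symmetric edge relation: the classes of the equivalence relation of being joined by a path.\<close>

definition connected_components :: "('n \<times> 'n) set \<Rightarrow> 'n set set" where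
  "connected_components E = UNIV // E\<^sup>*"

end

theory Submission
  imports Defs
begin

text \<open>Only finitely much weight flows between different components of the infinite flow graph, so
  from some time \<open>T\<close> on at most \<open>1/4\<close> does. By a comparison principle, a solution with
  \<open>\<bar>x\<^sub>i(T)\<bar> \<le> 1\<close> for all \<open>i\<close> that equals \<open>1\<close> on a component at time \<open>T\<close> stays at least \<open>1/2\<close> there.
  Hence no nonzero solution that is constant on components at time \<open>T\<close> tends to zero. As \<open>\<Phi>(T, 0)\<close>
  is injective, the image of the null space under it has the same dimension, and it meets the space
  of vectors constant on components only in \<open>0\<close>.\<close>

subsection \<open>Linear Caratheodory equations\<close>

locale locally_integrable_matrix =
  fixes A :: "real \<Rightarrow> real^'n^'n"
  assumes entry_integrable: "0 \<le> T \<Longrightarrow> (\<lambda>t. A t $ i $ j) absolutely_integrable_on {0..T}"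
begin

definition entry_norm :: "real \<Rightarrow> real" where
  "entry_norm t = (\<Sum>i\<in>UNIV. \<Sum>j\<in>UNIV. \<bar>A t $ i $ j\<bar>)"

text \<open>\<open>growth\<close> serves as a clock: a function bounded by \<open>C\<close> makes
  the right-hand side integrate to at most \<open>C\<close> times the increment of
  \<open>growth\<close>. Since \<open>A\<close> may be unbounded, short intervals are those on which
  \<open>growth\<close> increases little.\<close>

definition growth :: "real \<Rightarrow> real" where
  "growth t = integral {0..t} entry_norm"

text \<open>The equation is stated with \<open>integral\<close>, whose default value for a
  non-integrable function does no harm: for \<open>0 \<le> a\<close>, continuity of \<open>x\<close>
  makes the integrand integrable.\<close>

definition solution_on :: "real \<Rightarrow> real \<Rightarrow> (real \<Rightarrow> real^'n) \<Rightarrow> bool" where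
  "solution_on a b x \<longleftrightarrow> continuous_on {a..b} x \<and>
     (\<forall>t\<in>{a..b}. x t = x a + integral {a..t} (\<lambda>s. A s *v x s))"

lemma solution_on_continuous: "solution_on a b x \<Longrightarrow> continuous_on {a..b} x"
  by (simp add: solution_on_def)

lemma solution_on_integral:
  assumes "solution_on a b x" "a \<le> t" "t \<le> b"
  shows "integral {a..t} (\<lambda>s. A s *v x s) = x t - x a"
proof -
  have *: "x t = x a + integral {a..t} (\<lambda>s. A s *v x s)"
    using assms unfolding solution_on_def by (meson atLeastAtMost_iff)
  show ?thesis by (subst *) (rule add_diff_cancel_left'[symmetric])
qed

lemma solution_onI:
  assumes "continuous_on {a..b} x"
    and "\<And>t. a \<le> t \<Longrightarrow> t \<le> b \<Longrightarrow> integral {a..t} (\<lambda>s. A s *v x s) = x t - x a"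
  shows "solution_on a b x"
proof -
  have "x t = x a + integral {a..t} (\<lambda>s. A s *v x s)" if "t \<in> {a..b}" for t
    using that by (subst assms(2)) simp_all
  then show ?thesis unfolding solution_on_def using assms(1) by blast
qed

lemma entry_integrable_interval:
  assumes "0 \<le> a"
  shows "(\<lambda>t. A t $ i $ j) absolutely_integrable_on {a..b}"
proof (cases "a \<le> b")
  case True
  then show ?thesis
    using assms by (intro set_integrable_subset[OF entry_integrable[of b]]) auto
qed simp

section \<open>Estimates by the entry norm and its integral\<close>

lemma entry_norm_nonneg: "0 \<le> entry_norm t"
  by (simp add: entry_norm_def sum_nonneg)

lemma entry_norm_integrable:
  assumes "0 \<le> a"
  shows "entry_norm integrable_on {a..b}"
  unfolding entry_norm_def
  using entry_integrable_interval[OF assms]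
  by (intro integrable_sum finite) (simp add: absolutely_integrable_on_def)

lemma row_sum_le_entry_norm: "(\<Sum>j\<in>J. \<bar>A t $ i $ j\<bar>) \<le> entry_norm t"
proof -
  have "(\<Sum>j\<in>J. \<bar>A t $ i $ j\<bar>) \<le> (\<Sum>j\<in>UNIV. \<bar>A t $ i $ j\<bar>)"
    by (intro sum_mono2) auto
  also have "\<dots> \<le> entry_norm t"
    unfolding entry_norm_def by (rule member_le_sum) (auto intro: sum_nonneg)
  finally show ?thesis .
qed

lemma norm_matrix_vector_mult_le: "norm (A t *v x) \<le> entry_norm t * norm x"
proof -
  have "norm (A t *v x) \<le> (\<Sum>i\<in>UNIV. \<bar>(A t *v x) $ i\<bar>)"
    by (rule norm_le_l1_cart)
  also have "\<dots> \<le> (\<Sum>i\<in>UNIV. (\<Sum>j\<in>UNIV. \<bar>A t $ i $ j\<bar>) * norm x)"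
  proof (rule sum_mono)
    fix i
    have "\<bar>(A t *v x) $ i\<bar> \<le> (\<Sum>j\<in>UNIV. \<bar>A t $ i $ j * x $ j\<bar>)"
      unfolding matrix_vector_mult_def by simp
    also have "\<dots> \<le> (\<Sum>j\<in>UNIV. \<bar>A t $ i $ j\<bar> * norm x)"
      by (intro sum_mono) (simp add: abs_mult mult_left_mono component_le_norm_cart)
    finally show "\<bar>(A t *v x) $ i\<bar> \<le> (\<Sum>j\<in>UNIV. \<bar>A t $ i $ j\<bar>) * norm x"
      by (simp add: sum_distrib_right)
  qed
  finally show ?thesis
    by (simp add: entry_norm_def sum_distrib_right)
qed

lemma growth_diff:
  assumes "0 \<le> a" "a \<le> b"
  shows "integral {a..b} entry_norm = growth b - growth a"
  using Henstock_Kurzweil_Integration.integral_combine[OF assms entry_norm_integrable[OF order_refl]]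
  by (simp add: growth_def)

lemma growth_mono:
  assumes "0 \<le> a" "a \<le> b"
  shows "growth a \<le> growth b"
  using growth_diff[OF assms] integral_nonneg[OF entry_norm_integrable[OF assms(1)], of b]
  by (simp add: entry_norm_nonneg)

lemma growth_0 [simp]: "growth 0 = 0"
  by (simp add: growth_def)

lemma growth_nonneg: "0 \<le> t \<Longrightarrow> 0 \<le> growth t"
  using growth_mono[of 0 t] by simp

lemma continuous_on_growth: "continuous_on {0..b} growth"
  unfolding growth_def
  by (rule indefinite_integral_continuous_1[OF entry_norm_integrable[OF order_refl]])

lemma growth_small_increment:
  assumes "0 \<le> t" "t \<le> b" "0 < e"
  obtains d where "0 < d" "\<And>s. 0 \<le> s \<Longrightarrow> s \<le> b \<Longrightarrow> \<bar>s - t\<bar> < d \<Longrightarrow> \<bar>growth s - growth t\<bar> < e"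
proof -
  have "t \<in> {0..b}" using assms by simp
  from continuous_on_growth[of b, unfolded continuous_on_iff, rule_format, OF this assms(3)]
  show thesis using that by (auto simp: dist_real_def)
qed

section \<open>Integrability of the right-hand side\<close>

text \<open>A continuous factor is bounded and measurable on a compact interval, so it preserves
  absolute integrability.\<close>

lemma entry_mult_integrable:
  assumes "0 \<le> a" "continuous_on {a..b} f"
  shows "(\<lambda>s. A s $ i $ j * f s) absolutely_integrable_on {a..b}"
proof -
  have "(\<lambda>s. f s * A s $ i $ j) absolutely_integrable_on {a..b}"
  proof (rule absolutely_integrable_bounded_measurable_product_real)
    show "f \<in> borel_measurable (lebesgue_on {a..b})"
      using assms by (intro continuous_imp_measurable_on_sets_lebesgue) auto
    show "bounded (f ` {a..b})"
      using assms by (intro compact_imp_bounded compact_continuous_image) auto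
  qed (use entry_integrable_interval[OF assms(1)] in auto)
  then show ?thesis by (simp add: mult.commute)
qed

text \<open>The form with general \<open>J\<close> and \<open>f\<close> covers both the rows of
  \<open>A s *v x s\<close> and the sums of differences over a vertex set in the comparison
  principle.\<close>

lemma row_sum_integrable:
  assumes "0 \<le> a" "\<And>j. j \<in> J \<Longrightarrow> continuous_on {a..b} (f j)"
  shows "(\<lambda>s. \<Sum>j\<in>J. A s $ i $ j * f j s) integrable_on {a..b}"
proof (rule integrable_sum)
  show "finite J" by simp
  fix j assume "j \<in> J"
  then show "(\<lambda>s. A s $ i $ j * f j s) integrable_on {a..b}"
    using entry_mult_integrable[OF assms] by (simp add: absolutely_integrable_on_def)
qed

lemma matrix_vector_mult_integrable:
  assumes "0 \<le> a" "continuous_on {a..b} x"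
  shows "(\<lambda>s. A s *v x s) integrable_on {a..b}"
proof (rule integrable_componentwise)
  fix v :: "real^'n" assume "v \<in> Basis"
  then obtain i where "v = axis i 1" by (auto simp: Basis_vec_def)
  moreover have "(\<lambda>s. \<Sum>j\<in>UNIV. A s $ i $ j * x s $ j) integrable_on {a..b}"
    using assms by (intro row_sum_integrable continuous_intros)
  ultimately show "(\<lambda>s. (A s *v x s) \<bullet> v) integrable_on {a..b}"
    by (simp add: inner_axis matrix_vector_mult_def)
qed

text \<open>This estimate drives both the uniqueness proof and the contraction argument for
  existence.\<close>

lemma norm_integral_matrix_vector_mult_le:
  assumes "0 \<le> a" "a \<le> b" "continuous_on {a..b} x" "\<And>s. s \<in> {a..b} \<Longrightarrow> norm (x s) \<le> C"
  shows "norm (integral {a..b} (\<lambda>s. A s *v x s)) \<le> C * (growth b - growth a)"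
proof -
  have "norm (integral {a..b} (\<lambda>s. A s *v x s)) \<le> integral {a..b} (\<lambda>s. C * entry_norm s)"
  proof (rule integral_norm_bound_integral)
    fix s assume "s \<in> {a..b}"
    then have "entry_norm s * norm (x s) \<le> C * entry_norm s"
      by (metis assms(4) entry_norm_nonneg mult.commute mult_right_mono)
    then show "norm (A s *v x s) \<le> C * entry_norm s"
      using norm_matrix_vector_mult_le order_trans by blast
  qed (use assms matrix_vector_mult_integrable integrable_on_cmult_left[OF entry_norm_integrable] in auto)
  then show ?thesis
    using growth_diff[OF assms(1,2)] by simp
qed

section \<open>Increments, superposition and uniqueness of solutions\<close>

lemma solution_on_increment:
  assumes "solution_on a b x" "0 \<le> a" "a \<le> s" "s \<le> t" "t \<le> b"
  shows "x t - x s = integral {s..t} (\<lambda>r. A r *v x r)"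
proof -
  have "continuous_on {a..t} x"
    by (rule continuous_on_subset[OF solution_on_continuous[OF assms(1)]]) (use assms in auto)
  then have "integral {a..s} (\<lambda>r. A r *v x r) + integral {s..t} (\<lambda>r. A r *v x r)
      = integral {a..t} (\<lambda>r. A r *v x r)"
    using assms(2-4)
    by (intro Henstock_Kurzweil_Integration.integral_combine matrix_vector_mult_integrable) auto
  moreover have "integral {a..t} (\<lambda>r. A r *v x r) = x t - x a" "integral {a..s} (\<lambda>r. A r *v x r) = x s - x a"
    using assms by (auto intro: solution_on_integral)
  ultimately show ?thesis by (simp add: algebra_simps)
qed

text \<open>Two coefficients make sums, differences, negatives and scalings instances of one
  statement.\<close>

lemma solution_on_linear_combination:
  assumes x: "solution_on a b x" and y: "solution_on a b y" and "0 \<le> a"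
  shows "solution_on a b (\<lambda>t. c *\<^sub>R x t + d *\<^sub>R y t)"
proof (rule solution_onI)
  show "continuous_on {a..b} (\<lambda>t. c *\<^sub>R x t + d *\<^sub>R y t)"
    using x y by (intro continuous_intros solution_on_continuous)
  fix t assume t: "a \<le> t" "t \<le> b"
  have *: "continuous_on {a..t} x" "continuous_on {a..t} y"
    using t by (auto intro: continuous_on_subset[OF solution_on_continuous[OF x]]
        continuous_on_subset[OF solution_on_continuous[OF y]])
  have "integral {a..t} (\<lambda>s. A s *v (c *\<^sub>R x s + d *\<^sub>R y s))
      = integral {a..t} (\<lambda>s. c *\<^sub>R (A s *v x s) + d *\<^sub>R (A s *v y s))"
    by (simp only: matrix_vector_right_distrib matrix_vector_mult_scaleR)
  also have "\<dots> = c *\<^sub>R integral {a..t} (\<lambda>s. A s *v x s) + d *\<^sub>R integral {a..t} (\<lambda>s. A s *v y s)"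
    using assms(3) *
    by (simp only: Henstock_Kurzweil_Integration.integral_add integrable_cmul
        matrix_vector_mult_integrable Henstock_Kurzweil_Integration.integral_cmul)
  also have "\<dots> = (c *\<^sub>R x t + d *\<^sub>R y t) - (c *\<^sub>R x a + d *\<^sub>R y a)"
    using t by (simp add: solution_on_integral[OF x] solution_on_integral[OF y] algebra_simps)
  finally show "integral {a..t} (\<lambda>s. A s *v (c *\<^sub>R x s + d *\<^sub>R y s))
      = (c *\<^sub>R x t + d *\<^sub>R y t) - (c *\<^sub>R x a + d *\<^sub>R y a)" .
qed

text \<open>The zero set of a solution is closed by continuity, and relatively open because on a short
  interval around a zero the maximum of \<open>norm x\<close> is at most half of itself.\<close>

lemma solution_on_eq_0:
  assumes sol: "solution_on 0 b x" and "t0 \<in> {0..b}" "x t0 = 0" and "t \<in> {0..b}"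
  shows "x t = 0"
proof -
  have cont: "continuous_on {0..b} x" using sol by (rule solution_on_continuous)
  define Z where "Z = {0..b} \<inter> x -` {0}"
  have "closedin (top_of_set {0..b}) Z"
    unfolding Z_def by (rule continuous_closedin_preimage[OF cont closed_singleton])
  moreover have "openin (top_of_set {0..b}) Z"
    unfolding openin_euclidean_subtopology_iff
  proof (intro conjI ballI)
    show "Z \<subseteq> {0..b}" by (auto simp: Z_def)
    fix z assume "z \<in> Z"
    then have z: "0 \<le> z" "z \<le> b" "x z = 0" by (auto simp: Z_def)
    obtain d where d: "0 < d"
      "\<And>s. 0 \<le> s \<Longrightarrow> s \<le> b \<Longrightarrow> \<bar>s - z\<bar> < d \<Longrightarrow> \<bar>growth s - growth z\<bar> < 1/2"
      using growth_small_increment[OF z(1,2), of "1/2"] by auto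
    \<comment> \<open>The bounds are clipped to stay inside \<open>{0..b}\<close>; half of
      \<open>d\<close> keeps the closed interval within distance less than \<open>d\<close> of
      \<open>z\<close>.\<close>
    define p q where "p = max 0 (z - d/2)" and "q = min b (z + d/2)"
    define I where "I = {p..q}"
    have I: "I \<subseteq> {0..b}" "z \<in> I" "compact I"
      using z d(1) by (auto simp: I_def p_def q_def)
    obtain m where m: "m \<in> I" "\<And>s. s \<in> I \<Longrightarrow> norm (x s) \<le> norm (x m)"
      using continuous_attains_sup[of I "\<lambda>s. norm (x s)"] I
        continuous_on_norm[OF continuous_on_subset[OF cont I(1)]] by blast
    have gr: "\<bar>growth m - growth z\<bar> < 1/2"
      using m(1) d(1) by (intro d(2)) (auto simp: I_def p_def q_def)
    have sub: "{z..m} \<subseteq> I" "{m..z} \<subseteq> I" "0 \<le> m" "m \<le> b"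
      using m(1) I(1,2) by (auto simp: I_def)
    have "norm (x m) \<le> norm (x m) * \<bar>growth m - growth z\<bar>"
    proof (cases "z \<le> m")
      case True
      have "x m = integral {z..m} (\<lambda>r. A r *v x r)"
        using solution_on_increment[OF sol _ z(1) True sub(4)] z(3) by simp
      also have "norm \<dots> \<le> norm (x m) * (growth m - growth z)"
        using True m(2) I(1) z(1) sub(1)
        by (intro norm_integral_matrix_vector_mult_le continuous_on_subset[OF cont]) blast+
      also have "\<dots> \<le> norm (x m) * \<bar>growth m - growth z\<bar>"
        by (intro mult_left_mono) auto
      finally show ?thesis .
    next
      case False
      have "norm (x m) = norm (x z - x m)" using z(3) by simp
      also have "x z - x m = integral {m..z} (\<lambda>r. A r *v x r)"
        using solution_on_increment[OF sol _ sub(3) _ z(2)] False by simp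
      also have "norm \<dots> \<le> norm (x m) * (growth z - growth m)"
        using False m(2) I(1) sub(2,3)
        by (intro norm_integral_matrix_vector_mult_le continuous_on_subset[OF cont])
          (blast | simp)+
      also have "\<dots> \<le> norm (x m) * \<bar>growth m - growth z\<bar>"
        by (intro mult_left_mono) auto
      finally show ?thesis .
    qed
    moreover have "norm (x m) * \<bar>growth m - growth z\<bar> \<le> norm (x m) * (1/2)"
      using gr by (intro mult_left_mono) auto
    ultimately have m0: "norm (x m) = 0"
      using norm_ge_zero[of "x m"] by linarith
    have "s \<in> Z" if "s \<in> {0..b}" "dist s z < d/2" for s
    proof -
      have "z - d/2 \<le> s" "s \<le> z + d/2"
        using that(2) unfolding dist_real_def by linarith+
      then have "s \<in> I" using that(1) by (simp add: I_def p_def q_def)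
      then show ?thesis using m(2)[of s] m0 that(1) by (simp add: Z_def)
    qed
    then show "\<exists>e>0. \<forall>s\<in>{0..b}. dist s z < e \<longrightarrow> s \<in> Z"
      using d(1) by (intro exI[of _ "d/2"]) auto
  qed
  ultimately have "Z = {} \<or> Z = {0..b}"
    using connected_clopen connected_Icc by blast
  moreover have "t0 \<in> Z" unfolding Z_def using assms(2,3) by blast
  ultimately have "t \<in> Z" using assms(4) by blast
  then show ?thesis unfolding Z_def by blast
qed

text \<open>Agreement at an arbitrary time \<open>t0\<close> is allowed: agreement at
  \<open>0\<close> gives linearity of the solution map, agreement at a later time gives its
  injectivity.\<close>

lemma solution_on_unique:
  assumes "solution_on 0 b x" "solution_on 0 b y" "t0 \<in> {0..b}" "x t0 = y t0" "t \<in> {0..b}"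
  shows "x t = y t"
proof -
  have "1 *\<^sub>R x t + (-1) *\<^sub>R y t = 0"
    using assms(4)
    by (intro solution_on_eq_0[OF solution_on_linear_combination[OF assms(1,2)] assms(3) _ assms(5)]) simp_all
  then show ?thesis by simp
qed

section \<open>Existence of solutions\<close>

text \<open>The solution is the fixed point of the Picard operator on bounded continuous functions,
  which the bound on \<open>growth\<close> makes a contraction with constant
  \<open>1/2\<close>.\<close>

lemma local_existence:
  assumes "0 \<le> a" "a \<le> b" "growth b - growth a \<le> 1/2"
  obtains x where "solution_on a b x" "x a = v"
proof -
  \<comment> \<open>The Picard image has to be an element of the type of bounded continuous
    functions on the whole line. Precomposing with \<open>clamp\<close> extends it constantly
    outside \<open>{a..b}\<close>.\<close>
  have ex: "\<exists>y :: real \<Rightarrow>\<^sub>C (real^'n). \<forall>t. y t = v + integral {a..clamp a b t} (\<lambda>s. A s *v x s)"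
    for x :: "real \<Rightarrow>\<^sub>C (real^'n)"
  proof -
    have "continuous_on (cbox a b) (\<lambda>t. v + integral {a..t} (\<lambda>s. A s *v x s))"
      using indefinite_integral_continuous_1[OF matrix_vector_mult_integrable[OF assms(1)]]
      by (auto intro!: continuous_intros)
    then obtain y :: "real \<Rightarrow>\<^sub>C (real^'n)" where
      "\<And>t. y t = v + integral {a..clamp a b t} (\<lambda>s. A s *v x s)"
      by (rule continuous_on_cbox_bcontfunE) blast
    then show ?thesis by blast
  qed
  define K where "K x = (SOME y :: real \<Rightarrow>\<^sub>C (real^'n).
      \<forall>t. y t = v + integral {a..clamp a b t} (\<lambda>s. A s *v x s))" for x :: "real \<Rightarrow>\<^sub>C (real^'n)"
  have K: "K x t = v + integral {a..clamp a b t} (\<lambda>s. A s *v x s)" for x t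
    using someI_ex[OF ex[of x]] by (simp add: K_def)
  have "\<exists>!x. K x = x"
  proof (rule banach_fix_type)
    show "\<forall>x y. dist (K x) (K y) \<le> 1/2 * dist x y"
    proof (intro allI dist_bound)
      fix x y :: "real \<Rightarrow>\<^sub>C (real^'n)" and t
      define c where "c = clamp a b t"
      have c: "a \<le> c" "c \<le> b"
        using clamp_in_interval[of a b t] assms(2) by (auto simp: c_def)
      have "dist (K x t) (K y t) = norm (integral {a..c} (\<lambda>s. A s *v (x s - y s)))"
        unfolding K c_def[symmetric] dist_norm
        by (simp add: matrix_vector_mult_diff_distrib assms(1) matrix_vector_mult_integrable
            Henstock_Kurzweil_Integration.integral_diff)
      also have "\<dots> \<le> dist x y * (growth c - growth a)"
        using assms c by (intro norm_integral_matrix_vector_mult_le continuous_intros)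
          (auto simp: dist_norm[symmetric] dist_bounded)
      also have "\<dots> \<le> dist x y * (1/2)"
        using growth_mono[of c b] assms c by (intro mult_left_mono) auto
      finally show "dist (K x t) (K y t) \<le> 1/2 * dist x y" by simp
    qed
  qed auto
  then obtain x where "K x = x" by auto
  then have x: "x t = v + integral {a..clamp a b t} (\<lambda>s. A s *v x s)" for t
    using K[of x t] by simp
  have cl: "clamp a b t = t" if "t \<in> {a..b}" for t
    using that by (intro clamp_cancel_cbox) auto
  have "x a = v"
    using x[of a] cl[of a] assms(2) by simp
  moreover have "solution_on a b x"
  proof (rule solution_onI)
    fix t assume "a \<le> t" "t \<le> b"
    then show "integral {a..t} (\<lambda>s. A s *v x s) = x t - x a"
      using x[of t] cl[of t] calculation by simp
  qed simp
  ultimately show thesis using that by blast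
qed

text \<open>The integral splits at \<open>c\<close> into the increments of \<open>x\<close> and
  \<open>z\<close>, which telescope because the two solutions meet there.\<close>

lemma solution_on_append:
  assumes x: "solution_on a c x" and z: "solution_on c b z" and "x c = z c" "0 \<le> a" "a \<le> c" "c \<le> b"
  shows "solution_on a b (\<lambda>t. if t \<le> c then x t else z t)" (is "solution_on a b ?u")
proof (rule solution_onI)
  have "continuous_on ({a..c} \<union> {c..b}) ?u"
    using assms solution_on_continuous[OF x] solution_on_continuous[OF z]
    by (intro continuous_on_cases) auto
  moreover have "{a..c} \<union> {c..b} = {a..b}" using assms(5,6) by auto
  ultimately show cont: "continuous_on {a..b} ?u" by simp
  have first: "integral {a..t} (\<lambda>s. A s *v ?u s) = ?u t - ?u a" if "a \<le> t" "t \<le> c" for t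
  proof -
    have "integral {a..t} (\<lambda>s. A s *v ?u s) = integral {a..t} (\<lambda>s. A s *v x s)"
      using that by (intro integral_cong) auto
    then show ?thesis using that assms(5) solution_on_integral[OF x that] by simp
  qed
  fix t assume t: "a \<le> t" "t \<le> b"
  show "integral {a..t} (\<lambda>s. A s *v ?u s) = ?u t - ?u a"
  proof (cases "t \<le> c")
    case False
    have "integral {c..t} (\<lambda>s. A s *v ?u s) = integral {c..t} (\<lambda>s. A s *v z s)"
      using assms(3) by (intro integral_cong) auto
    also have "\<dots> = ?u t - ?u c"
      using t False assms(3) solution_on_integral[OF z, of t] by simp
    finally have "integral {c..t} (\<lambda>s. A s *v ?u s) = ?u t - ?u c" .
    moreover have "integral {a..c} (\<lambda>s. A s *v ?u s) = ?u c - ?u a"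
      using first[of c] assms(5) by simp
    moreover have "integral {a..c} (\<lambda>s. A s *v ?u s) + integral {c..t} (\<lambda>s. A s *v ?u s)
        = integral {a..t} (\<lambda>s. A s *v ?u s)"
      using t False assms(4,5) continuous_on_subset[OF cont, of "{a..t}"]
      by (intro Henstock_Kurzweil_Integration.integral_combine matrix_vector_mult_integrable) auto
    ultimately show ?thesis
      by (metis (no_types, lifting) add.commute diff_add_cancel diff_add_eq)
  qed (use first t in blast)
qed

lemma solution_on_subset:
  assumes "solution_on a b x" "c \<le> b"
  shows "solution_on a c x"
proof (rule solution_onI)
  show "continuous_on {a..c} x"
    by (rule continuous_on_subset[OF solution_on_continuous[OF assms(1)]]) (use assms(2) in auto)
qed (use assms solution_on_integral in auto)

text \<open>Induction on the number of pieces along each of which \<open>growth\<close> increases by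
  at most \<open>1/2\<close>; local existence fills the last piece.\<close>

lemma existence_bounded_growth:
  assumes "0 \<le> b" "growth b \<le> of_nat n / 2"
  shows "\<exists>x. solution_on 0 b x \<and> x 0 = v"
  using assms
proof (induction n arbitrary: b)
  case 0
  then have "growth b - growth 0 \<le> 1/2" by simp
  then show ?case using local_existence[of 0 b v] 0 by auto
next
  case (Suc n)
  \<comment> \<open>The minimum keeps the target within the range of \<open>growth\<close> on
    \<open>{0..b}\<close>. If it equals \<open>growth b\<close>, the last piece carries no
    growth.\<close>
  have "\<exists>c. 0 \<le> c \<and> c \<le> b \<and> growth c = min (of_nat n / 2) (growth b)"
    using Suc.prems by (intro IVT' continuous_on_growth) (auto simp: growth_nonneg)
  then obtain c where c: "0 \<le> c" "c \<le> b" "growth c = min (of_nat n / 2) (growth b)"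
    by blast
  obtain x where x: "solution_on 0 c x" "x 0 = v"
    using Suc.IH[of c] c(1,3) by (metis min.cobounded1)
  obtain z where z: "solution_on c b z" "z c = x c"
    using local_existence[of c b "x c"] c Suc.prems(2) by (auto simp: min_def field_simps split: if_splits)
  show ?case
    using solution_on_append[OF x(1) z(1) z(2)[symmetric]] c x(2) by auto
qed

lemma existence:
  assumes "0 \<le> b"
  obtains x where "solution_on 0 b x" "x 0 = v"
proof -
  obtain n :: nat where "growth b * 2 \<le> of_nat n" using real_arch_simple by blast
  then show thesis using existence_bounded_growth[OF assms, of n v] that by auto
qed

lemma is_solution_iff: "is_solution A 0 x \<longleftrightarrow> (\<forall>b\<ge>0. solution_on 0 b x)"
proof
  assume sol: "is_solution A 0 x"
  show "\<forall>b\<ge>0. solution_on 0 b x"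
  proof (intro allI impI solution_onI)
    fix b show "continuous_on {0..b} x"
      using sol by (auto simp: is_solution_def intro: continuous_on_subset)
  next
    fix t :: real assume "0 \<le> t"
    then show "integral {0..t} (\<lambda>s. A s *v x s) = x t - x 0"
      using sol by (auto simp: is_solution_def intro: integral_unique)
  qed
next
  assume sol: "\<forall>b\<ge>0. solution_on 0 b x"
  \<comment> \<open>Continuity is local, and near \<open>t\<close> the half-line coincides with
    \<open>{0..t + 1}\<close>.\<close>
  have "continuous (at t within {0..}) x" if "t \<in> {0..}" for t
  proof -
    have "solution_on 0 (t + 1) x" using sol that by simp
    then have "continuous (at t within {0..t + 1}) x"
      using that solution_on_continuous by (auto simp: continuous_on_eq_continuous_within)
    moreover have "at t within {0..t + 1} = at t within {0..}"
      by (rule at_within_nhd[of _ "{..<t + 1}"]) auto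
    ultimately show ?thesis by simp
  qed
  moreover have "((\<lambda>s. A s *v x s) has_integral (x t - x 0)) {0..t}" if "0 \<le> t" for t
  proof -
    have t: "solution_on 0 t x" using sol that by blast
    show ?thesis
      using integrable_integral[OF matrix_vector_mult_integrable[OF order_refl solution_on_continuous[OF t]]]
        solution_on_integral[OF t that order_refl] by simp
  qed
  ultimately show "is_solution A 0 x"
    by (simp add: is_solution_def continuous_on_eq_continuous_within)
qed

text \<open>Solutions on intervals of different lengths agree on the shorter one, so the diagonal
  \<open>y t t\<close> solves the equation on the whole half-line.\<close>

lemma global_existence: "\<exists>x. is_solution A 0 x \<and> x 0 = v"
proof -
  have "\<forall>b. \<exists>x. 0 \<le> b \<longrightarrow> solution_on 0 b x \<and> x 0 = v"
    using existence[of _ v] by metis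
  then obtain y where y: "\<And>b. 0 \<le> b \<Longrightarrow> solution_on 0 b (y b)" "\<And>b. 0 \<le> b \<Longrightarrow> y b 0 = v"
    by metis
  have "solution_on 0 b (\<lambda>t. y t t)" if b: "0 \<le> b" for b
  proof -
    have eq: "y t t = y b t" if "0 \<le> t" "t \<le> b" for t
      using that solution_on_unique[OF y(1) solution_on_subset[OF y(1)[OF b]], of t 0 t] y(2) b by simp
    show ?thesis
    proof (rule solution_onI)
      show "continuous_on {0..b} (\<lambda>t. y t t)"
        using solution_on_continuous[OF y(1)[OF b]] eq
        by (subst continuous_on_cong[OF refl, of _ _ "y b"]) auto
      fix t assume t: "0 \<le> t" "t \<le> b"
      have "integral {0..t} (\<lambda>s. A s *v y s s) = integral {0..t} (\<lambda>s. A s *v y b s)"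
        using t eq by (intro integral_cong) auto
      then show "integral {0..t} (\<lambda>s. A s *v y s s) = y t t - y 0 0"
        using solution_on_integral[OF y(1)[OF b] t] eq t b by simp
    qed
  qed
  then show ?thesis
    using y(2) by (intro exI[of _ "\<lambda>t. y t t"]) (simp add: is_solution_iff)
qed

section \<open>The solution map and the state transition matrix\<close>

text \<open>Uniqueness determines the chosen function for \<open>t \<ge> 0\<close>; its values at
  negative times are arbitrary.\<close>

definition sol :: "real^'n \<Rightarrow> real \<Rightarrow> real^'n" where
  "sol v = (SOME x. is_solution A 0 x \<and> x 0 = v)"

lemma sol_properties: "is_solution A 0 (sol v) \<and> sol v 0 = v"
  unfolding sol_def
  by (rule someI_ex[where P = "\<lambda>x. is_solution A 0 x \<and> x 0 = v", OF global_existence])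

lemmas is_solution_sol = sol_properties[THEN conjunct1]
  and sol_0 [simp] = sol_properties[THEN conjunct2]

lemma solution_on_sol: "0 \<le> b \<Longrightarrow> solution_on 0 b (sol v)"
  using is_solution_sol[of v] unfolding is_solution_iff by blast

lemma sol_unique:
  assumes "is_solution A 0 x" "0 \<le> t"
  shows "x t = sol (x 0) t"
proof (rule solution_on_unique[OF _ solution_on_sol[OF assms(2)]])
  show "solution_on 0 t x" using assms unfolding is_solution_iff by blast
  show "x 0 = sol (x 0) 0" by (rule sol_0[symmetric])
qed (use assms(2) in auto)

lemma linear_sol:
  assumes "0 \<le> t"
  shows "linear (\<lambda>v. sol v t)"
proof -
  have comb: "sol (c *\<^sub>R v + d *\<^sub>R w) t = c *\<^sub>R sol v t + d *\<^sub>R sol w t" for c d v w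
    by (rule solution_on_unique[OF solution_on_sol[OF assms]
        solution_on_linear_combination[OF solution_on_sol[OF assms] solution_on_sol[OF assms]], of 0])
      (use assms in simp_all)
  show ?thesis
  proof
    show "sol (v + w) t = sol v t + sol w t" for v w
      using comb[of 1 v 1 w] by simp
    show "sol (c *\<^sub>R v) t = c *\<^sub>R sol v t" for c v
      using comb[of c v 0 v] by simp
  qed
qed

lemma inj_sol:
  assumes "0 \<le> t"
  shows "inj (\<lambda>v. sol v t)"
proof (rule injI)
  fix v w assume "sol v t = sol w t"
  then show "v = w"
    using solution_on_unique[OF solution_on_sol[OF assms] solution_on_sol[OF assms], of t v w 0] assms
    by (metis atLeastAtMost_iff order_refl sol_0)
qed

text \<open>The matrix of the solution map meets the description in \<open>state_transition\<close>
  by uniqueness of solutions. It is the only such matrix because every vector is the initial value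
  of some solution.\<close>

lemma state_transition_eq_sol:
  assumes "0 \<le> t"
  shows "state_transition A t 0 *v v = sol v t"
proof -
  let ?M = "matrix (\<lambda>v. sol v t)"
  have M: "?M *v v = sol v t" for v
    using matrix_vector_mul(2)[OF linear_sol[OF assms]] by metis
  have "state_transition A t 0 = ?M"
    unfolding state_transition_def
  proof (rule the_equality)
    show "\<forall>x. is_solution A 0 x \<longrightarrow> x t = ?M *v x 0"
      using M sol_unique[OF _ assms] by metis
    fix M assume "\<forall>x. is_solution A 0 x \<longrightarrow> x t = M *v x 0"
    then have "M *v v = ?M *v v" for v
      unfolding M using is_solution_sol[of v] sol_0[of v] by metis
    then show "M = ?M"
      by (subst matrix_eq) blast
  qed
  then show ?thesis by (simp only: M)
qed

lemma chain_null_eq: "chain_null A 0 = {v. (sol v \<longlongrightarrow> 0) at_top}"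
proof -
  have "eventually (\<lambda>t. state_transition A t 0 *v v = sol v t) at_top" for v
    using eventually_ge_at_top[of 0] by eventually_elim (rule state_transition_eq_sol)
  then show ?thesis
    unfolding chain_null_def by (intro Collect_cong tendsto_cong)
qed

end

subsection \<open>Averaging chains\<close>

locale averaging_chain = locally_integrable_matrix A for A :: "real \<Rightarrow> real^'n^'n" +
  assumes row_sum: "0 \<le> t \<Longrightarrow> (\<Sum>j\<in>UNIV. A t $ i $ j) = 0"
    and off_diagonal_nonneg: "0 \<le> t \<Longrightarrow> i \<noteq> j \<Longrightarrow> 0 \<le> A t $ i $ j"
begin

text \<open>If the conclusion failed, let \<open>c\<close> be the last time at which every \<open>y i\<close> is nonpositive, and
  let \<open>y k\<close> attain at \<open>p\<close> the maximum of all \<open>y j\<close> over a short interval after \<open>c\<close>. From the minimum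
  of \<open>y k\<close> on \<open>{c..p}\<close> up to \<open>p\<close>, the function \<open>y k\<close> would rise by at most half of its rise.\<close>

lemma comparison_principle:
  fixes y :: "'n \<Rightarrow> real \<Rightarrow> real"
  assumes "0 \<le> T" "T \<le> t"
    and cont: "\<And>i. i \<in> V \<Longrightarrow> continuous_on {T..t} (y i)"
    and inc: "\<And>i s r. i \<in> V \<Longrightarrow> T \<le> s \<Longrightarrow> s \<le> r \<Longrightarrow> r \<le> t \<Longrightarrow>
      y i r - y i s \<le> integral {s..r} (\<lambda>q. \<Sum>j\<in>V. A q $ i $ j * (y j q - y i q))"
    and init: "\<And>i. i \<in> V \<Longrightarrow> y i T \<le> 0"
    and "i \<in> V"
  shows "y i t \<le> 0"
proof (rule ccontr)
  assume pos: "\<not> y i t \<le> 0"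
  define Z where "Z = {s. T \<le> s \<and> s \<le> t \<and> (\<forall>i\<in>V. y i s \<le> 0)}"
  have "Z = {T..t} \<inter> (\<Inter>i\<in>V. {T..t} \<inter> y i -` {..0})" by (auto simp: Z_def)
  also have "compact \<dots>"
    using cont by (intro compact_Int_closed closed_INT ballI continuous_closed_preimage) auto
  finally have "compact Z" .
  moreover have "T \<in> Z" using assms(2) init by (auto simp: Z_def)
  ultimately obtain c where c: "c \<in> Z" "\<And>s. s \<in> Z \<Longrightarrow> s \<le> c"
    using compact_attains_sup[of Z] by blast
  have "c \<noteq> t" using c(1) pos assms(6) by (auto simp: Z_def)
  then have ct: "T \<le> c" "c < t" and yc: "\<And>j. j \<in> V \<Longrightarrow> y j c \<le> 0"
    using c(1) by (auto simp: Z_def)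
  obtain d where d: "0 < d"
    "\<And>s. 0 \<le> s \<Longrightarrow> s \<le> t \<Longrightarrow> \<bar>s - c\<bar> < d \<Longrightarrow> \<bar>growth s - growth c\<bar> < 1/2"
    using growth_small_increment[of c t "1/2"] ct assms(1) by auto
  define b where "b = min t (c + d/2)"
  have b: "c < b" "b \<le> t" using ct d(1) by (auto simp: b_def)
  have "\<bar>growth b - growth c\<bar> < 1/2"
    using b ct assms(1) d(1) by (intro d(2)) (auto simp: b_def)
  then have gb: "growth b - growth c < 1/2" by linarith
  have cont_sub: "continuous_on {r..s} (y j)" if "j \<in> V" "T \<le> r" "s \<le> t" for r s j
    using cont[OF that(1)] that(2,3) by (auto intro: continuous_on_subset)
  have "b \<notin> Z" using c(2)[of b] b(1) by auto
  then obtain l where l: "l \<in> V" "0 < y l b"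
    using b ct by (auto simp: Z_def)
  have "\<exists>s\<in>{c..b}. \<forall>r\<in>{c..b}. y j r \<le> y j s" if "j \<in> V" for j
    using cont_sub[OF that] ct b by (intro continuous_attains_sup) auto
  then obtain \<sigma> where \<sigma>: "\<And>j. j \<in> V \<Longrightarrow> \<sigma> j \<in> {c..b}"
    "\<And>j r. j \<in> V \<Longrightarrow> r \<in> {c..b} \<Longrightarrow> y j r \<le> y j (\<sigma> j)"
    by metis
  \<comment> \<open>Each \<open>y j\<close> is maximised over time first, then the finitely many
    maxima are compared.\<close>
  let ?Y = "(\<lambda>j. y j (\<sigma> j)) ` V"
  have "Max ?Y \<in> ?Y" using l(1) by (intro Max_in) auto
  then obtain k where k: "k \<in> V" "y k (\<sigma> k) = Max ?Y" by auto
  define p where "p = \<sigma> k"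
  have p: "c \<le> p" "p \<le> b" using \<sigma>(1)[OF k(1)] by (auto simp: p_def)
  have max: "y j r \<le> y k p" if "j \<in> V" "c \<le> r" "r \<le> b" for j r
  proof -
    have "y j r \<le> y j (\<sigma> j)" using that by (intro \<sigma>(2)) auto
    also have "\<dots> \<le> Max ?Y" using that(1) by (intro Max_ge) auto
    finally show ?thesis by (simp add: k(2) p_def)
  qed
  have "\<exists>s\<in>{c..p}. \<forall>r\<in>{c..p}. y k s \<le> y k r"
    using cont_sub[OF k(1)] ct b p by (intro continuous_attains_inf) auto
  then obtain s where s: "c \<le> s" "s \<le> p" "\<And>r. c \<le> r \<Longrightarrow> r \<le> p \<Longrightarrow> y k s \<le> y k r"
    by auto
  \<comment> \<open>On \<open>{s..p}\<close> this bounds every difference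
    \<open>y j q - y k q\<close>, since \<open>y j q \<le> y k p\<close> and
    \<open>y k s \<le> y k q\<close>.\<close>
  define m where "m = y k p - y k s"
  have "0 < y k p" using max[OF l(1), of b] l(2) b(1) by simp
  moreover have "y k s \<le> 0" using s(3)[of c] p yc[OF k(1)] by simp
  ultimately have m: "0 < m" by (simp add: m_def)
  have "m \<le> integral {s..p} (\<lambda>q. \<Sum>j\<in>V. A q $ k $ j * (y j q - y k q))"
    unfolding m_def using k(1) s ct p b by (intro inc) auto
  also have "\<dots> \<le> integral {s..p} (\<lambda>q. m * entry_norm q)"
  proof (rule integral_le)
    show "(\<lambda>q. \<Sum>j\<in>V. A q $ k $ j * (y j q - y k q)) integrable_on {s..p}"
      using k(1) s ct p b assms(1) by (intro row_sum_integrable continuous_intros cont_sub) auto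
    show "(\<lambda>q. m * entry_norm q) integrable_on {s..p}"
      using s ct assms(1) by (intro integrable_on_mult_right entry_norm_integrable) auto
    fix q assume q: "q \<in> {s..p}"
    have "(\<Sum>j\<in>V. A q $ k $ j * (y j q - y k q)) \<le> (\<Sum>j\<in>V. \<bar>A q $ k $ j\<bar> * m)"
    proof (rule sum_mono)
      fix j assume j: "j \<in> V"
      show "A q $ k $ j * (y j q - y k q) \<le> \<bar>A q $ k $ j\<bar> * m"
      \<comment> \<open>The diagonal entry may be negative, but the difference it multiplies is
        zero.\<close>
      proof (cases "j = k")
        case False
        have "0 \<le> A q $ k $ j" using q s ct assms(1) False by (intro off_diagonal_nonneg) auto
        moreover have "y j q - y k q \<le> m"
        proof -
          have "c \<le> q" "q \<le> p" "q \<le> b" using q s(1) p by auto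
          then show ?thesis
            unfolding m_def using max[OF j, of q] s(3)[of q] by linarith
        qed
        ultimately show ?thesis by (simp add: mult_left_mono)
      qed (use m in auto)
    qed
    also have "\<dots> = m * (\<Sum>j\<in>V. \<bar>A q $ k $ j\<bar>)" by (simp add: sum_distrib_left mult.commute)
    also have "\<dots> \<le> m * entry_norm q"
      using m by (intro mult_left_mono row_sum_le_entry_norm) auto
    finally show "(\<Sum>j\<in>V. A q $ k $ j * (y j q - y k q)) \<le> m * entry_norm q" .
  qed
  also have "\<dots> = m * (growth p - growth s)"
    using growth_diff[of s p] s ct assms(1) by simp
  also have "\<dots> \<le> m * (1/2)"
    using growth_mono[of c s] growth_mono[of p b] gb m s p ct assms(1) by (intro mult_left_mono) auto
  finally show False using m by simp
qed

section \<open>Bounds for solutions of averaging chains\<close>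

text \<open>Zero row sums allow \<open>x q $ i\<close> to be subtracted from every coordinate. This
  brings the equation into the form that the comparison principle expects.\<close>

lemma solution_on_component:
  assumes "solution_on 0 b x" "0 \<le> s" "s \<le> r" "r \<le> b"
  shows "x r $ i - x s $ i = integral {s..r} (\<lambda>q. \<Sum>j\<in>UNIV. A q $ i $ j * (x q $ j - x q $ i))"
proof -
  have "x r - x s = integral {s..r} (\<lambda>q. A q *v x q)"
    using assms by (intro solution_on_increment) auto
  then have "x r $ i - x s $ i = integral {s..r} (\<lambda>q. A q *v x q) $ i"
    by (metis vector_minus_component)
  also have "\<dots> = integral {s..r} (\<lambda>q. (A q *v x q) $ i)"
  proof -
    have "continuous_on {s..r} x"
      by (rule continuous_on_subset[OF solution_on_continuous[OF assms(1)]]) (use assms in auto)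
    then show ?thesis
      using assms(2) by (intro integral_component_eq_cart[symmetric] matrix_vector_mult_integrable)
  qed
  also have "\<dots> = integral {s..r} (\<lambda>q. \<Sum>j\<in>UNIV. A q $ i $ j * (x q $ j - x q $ i))"
  proof (rule integral_cong)
    fix q assume "q \<in> {s..r}"
    then have "(\<Sum>j\<in>UNIV. A q $ i $ j * x q $ i) = 0"
      using row_sum[of q i] assms(2) by (simp flip: sum_distrib_right)
    then show "(A q *v x q) $ i = (\<Sum>j\<in>UNIV. A q $ i $ j * (x q $ j - x q $ i))"
      by (simp add: matrix_vector_mult_def right_diff_distrib sum_subtractf)
  qed
  finally show ?thesis .
qed

lemma continuous_on_solution_component:
  assumes "solution_on 0 b x" "0 \<le> s" "r \<le> b"
  shows "continuous_on {s..r} (\<lambda>q. x q $ i)"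
proof -
  have "continuous_on {s..r} x"
    by (rule continuous_on_subset[OF solution_on_continuous[OF assms(1)]]) (use assms in auto)
  then show ?thesis by (intro continuous_intros)
qed

text \<open>The comparison principle applies on all vertices to \<open>x s $ i - M\<close>, as the
  constant cancels in differences.\<close>

lemma solution_upper_bound:
  assumes "solution_on 0 t x" "0 \<le> T" "T \<le> t" "\<And>i. x T $ i \<le> M"
  shows "x t $ i \<le> M"
proof -
  have "x t $ i - M \<le> 0"
  proof (rule comparison_principle[OF assms(2,3), where V = UNIV and y = "\<lambda>i s. x s $ i - M"])
    fix i s r assume "T \<le> s" "s \<le> r" "r \<le> t"
    then show "x r $ i - M - (x s $ i - M)
        \<le> integral {s..r} (\<lambda>q. \<Sum>j\<in>UNIV. A q $ i $ j * (x q $ j - M - (x q $ i - M)))"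
      using solution_on_component[OF assms(1), of s r i] assms(2) by simp
  next
    show "continuous_on {T..t} (\<lambda>s. x s $ i - M)" for i
      using assms(2)
      by (intro continuous_on_diff continuous_on_const continuous_on_solution_component[OF assms(1)]) auto
  qed (use assms(4) in auto)
  then show ?thesis by simp
qed

lemma solution_abs_bound:
  assumes "solution_on 0 t x" "0 \<le> T" "T \<le> t" "\<And>i. \<bar>x T $ i\<bar> \<le> M"
  shows "\<bar>x t $ i\<bar> \<le> M"
proof -
  have "x t $ i \<le> M"
    using assms(4) by (intro solution_upper_bound[OF assms(1-3)]) (metis abs_le_D1)
  \<comment> \<open>The lower bound is the upper bound for the negated solution, written as a linear
    combination.\<close>
  moreover have "((-1) *\<^sub>R x t + 0 *\<^sub>R x t) $ i \<le> M"
    using abs_le_D2[OF assms(4)]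
    by (intro solution_upper_bound[OF solution_on_linear_combination[OF assms(1,1)] assms(2,3)]) auto
  ultimately show ?thesis by simp
qed

text \<open>All coordinates stay in \<open>[-1, 1]\<close>, so vertices outside \<open>V\<close>
  raise the deficit \<open>1 - x s $ i\<close> of a vertex in \<open>V\<close> at rate at most
  \<open>2 * h s\<close>. With this accumulated loss subtracted, the deficits satisfy the comparison
  principle on \<open>V\<close> alone.\<close>

lemma solution_lower_bound_on_class:
  assumes sol: "solution_on 0 t x" and "0 \<le> T" "T \<le> t"
    and bound: "\<And>i. \<bar>x T $ i\<bar> \<le> 1" and one: "\<And>i. i \<in> V \<Longrightarrow> x T $ i = 1"
    and h: "h integrable_on {T..t}"
    and leak: "\<And>i s. i \<in> V \<Longrightarrow> T \<le> s \<Longrightarrow> s \<le> t \<Longrightarrow> (\<Sum>j\<in>-V. A s $ i $ j) \<le> h s"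
    and "i \<in> V"
  shows "1 - 2 * integral {T..t} h \<le> x t $ i"
proof -
  define y where "y i s = 1 - x s $ i - 2 * integral {T..s} h" for i s
  note cont = continuous_on_solution_component[OF sol]
  have "y i t \<le> 0"
  proof (rule comparison_principle[OF assms(2,3), where V = V and y = y])
    show "continuous_on {T..t} (y i)" for i
      unfolding y_def[abs_def] using assms(2)
      by (intro continuous_on_diff continuous_on_mult continuous_on_const cont
          indefinite_integral_continuous_1[OF h]) auto
    show "y i T \<le> 0" if "i \<in> V" for i
      using one[OF that] by (simp add: y_def)
  next
    fix i s r assume i: "i \<in> V" and sr: "T \<le> s" "s \<le> r" "r \<le> t"
    let ?F = "\<lambda>q. \<Sum>j\<in>V. A q $ i $ j * (y j q - y i q)"
    let ?G = "\<lambda>q. \<Sum>j\<in>UNIV. A q $ i $ j * (x q $ i - x q $ j)"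
    have h': "h integrable_on {s..r}"
      by (rule integrable_on_subinterval[OF h]) (use sr in auto)
    \<comment> \<open>The accumulated loss is the same for every index, so it cancels in
      \<open>y j q - y i q\<close>.\<close>
    have F: "?F = (\<lambda>q. \<Sum>j\<in>V. A q $ i $ j * (x q $ i - x q $ j))"
      by (simp add: y_def)
    have intF: "?F integrable_on {s..r}" and intG: "?G integrable_on {s..r}"
      unfolding F using sr assms(2) by (auto intro!: row_sum_integrable continuous_on_diff cont)
    have "?G = (\<lambda>q. - (\<Sum>j\<in>UNIV. A q $ i $ j * (x q $ j - x q $ i)))"
      by (simp add: right_diff_distrib flip: sum_negf)
    then have "integral {s..r} ?G = - integral {s..r} (\<lambda>q. \<Sum>j\<in>UNIV. A q $ i $ j * (x q $ j - x q $ i))"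
      by (simp only: Henstock_Kurzweil_Integration.integral_neg)
    also have "\<dots> = x s $ i - x r $ i"
      using solution_on_component[OF sol, of s r i] sr assms(2) by simp
    finally have G: "x s $ i - x r $ i = integral {s..r} ?G" ..
    have "integral {s..r} ?G \<le> integral {s..r} (\<lambda>q. ?F q + 2 * h q)"
    proof (rule integral_le)
      fix q assume q: "q \<in> {s..r}"
      have "?F q = (\<Sum>j\<in>V. A q $ i $ j * (x q $ i - x q $ j))"
        by (simp add: y_def)
      then have "?G q = ?F q + (\<Sum>j\<in>-V. A q $ i $ j * (x q $ i - x q $ j))"
        using sum.union_disjoint[of V "-V" "\<lambda>j. A q $ i $ j * (x q $ i - x q $ j)"] by simp
      also have "(\<Sum>j\<in>-V. A q $ i $ j * (x q $ i - x q $ j)) \<le> (\<Sum>j\<in>-V. A q $ i $ j * 2)"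
      proof (intro sum_mono mult_left_mono)
        fix j assume "j \<in> -V"
        then show "0 \<le> A q $ i $ j"
          using i q sr assms(2) by (intro off_diagonal_nonneg) auto
        have "\<bar>x q $ l\<bar> \<le> 1" for l
          by (rule solution_abs_bound[OF solution_on_subset[OF sol] assms(2) _ bound]) (use q sr in auto)
        from this[of i] this[of j] show "x q $ i - x q $ j \<le> 2" by linarith
      qed
      also have "\<dots> \<le> 2 * h q"
        using leak[OF i, of q] q sr by (simp flip: sum_distrib_right)
      finally show "?G q \<le> ?F q + 2 * h q" by simp
    qed (intro integrable_add integrable_on_mult_right intF intG h')+
    also have "\<dots> = integral {s..r} ?F + 2 * integral {s..r} h"
      using intF h' by (subst Henstock_Kurzweil_Integration.integral_add) (auto intro: integrable_on_mult_right)
    finally have "x s $ i - x r $ i \<le> integral {s..r} ?F + 2 * integral {s..r} h"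
      by (simp only: G)
    moreover have "integral {T..s} h + integral {s..r} h = integral {T..r} h"
      using sr by (intro Henstock_Kurzweil_Integration.integral_combine integrable_on_subinterval[OF h]) auto
    ultimately show "y i r - y i s \<le> integral {s..r} ?F"
      unfolding y_def by linarith
  qed fact
  then show ?thesis by (simp add: y_def)
qed

section \<open>Flow between different components\<close>

text \<open>Without an edge the two-way flow has a finite total, which dominates the flow in either
  direction because both are non-negative.\<close>

lemma entry_integral_bounded:
  assumes "i \<noteq> j" "(i, j) \<notin> infinite_flow_edges A"
  obtains C where "\<And>t. 0 \<le> t \<Longrightarrow> integral {0..t} (\<lambda>s. A s $ i $ j) \<le> C"
proof -
  let ?f = "\<lambda>s. A s $ i $ j + A s $ j $ i"
  let ?I = "\<integral>\<^sup>+s\<in>{0..}. ennreal (?f s) \<partial>lebesgue"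
  have fin: "?I < \<infinity>" using assms by (auto simp: infinite_flow_edges_def less_top)
  have "integral {0..t} (\<lambda>s. A s $ i $ j) \<le> enn2real ?I" if t: "0 \<le> t" for t
  proof -
    have int: "(\<lambda>s. A s $ k $ l) integrable_on {0..t}" for k l
      using entry_integrable[OF t] by (simp add: absolutely_integrable_on_def)
    have nonneg: "0 \<le> ?f s" "A s $ i $ j \<le> ?f s" if "s \<in> {0..t}" for s
      using that off_diagonal_nonneg assms(1) by auto
    have "ennreal (integral {0..t} ?f) = (\<integral>\<^sup>+s. ennreal (?f s) * indicator {0..t} s \<partial>lborel)"
      using nonneg int
      by (intro nn_integral_has_integral_lebesgue'[symmetric] integrable_integral integrable_add) auto
    \<comment> \<open>Non-negative integrals agree for Borel measure and its completion, the measure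
      used for the edges.\<close>
    also have "\<dots> = (\<integral>\<^sup>+s. ennreal (?f s) * indicator {0..t} s \<partial>lebesgue)"
      by (rule nn_integral_completion[symmetric])
    also have "\<dots> \<le> ?I"
      by (intro nn_integral_mono) (auto simp: indicator_def)
    finally have le: "ennreal (integral {0..t} ?f) \<le> ?I" .
    have "0 \<le> integral {0..t} ?f"
      by (rule integral_nonneg[OF integrable_add[OF int int] nonneg(1)])
    then have "integral {0..t} ?f \<le> enn2real ?I"
      using enn2real_mono[OF le fin[unfolded infinity_ennreal_def]] by (simp only: enn2real_ennreal)
    moreover have "integral {0..t} (\<lambda>s. A s $ i $ j) \<le> integral {0..t} ?f"
      using nonneg(2) int by (intro integral_le integrable_add) auto
    ultimately show ?thesis by linarith
  qed
  then show thesis using that by blast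
qed

text \<open>The complement of the reflexive transitive closure consists of the pairs in different
  components. It omits the diagonal, so every summand is non-negative for
  \<open>t \<ge> 0\<close>.\<close>

definition cross_flow :: "real \<Rightarrow> real" where
  "cross_flow t = (\<Sum>(i, j)\<in>-((infinite_flow_edges A)\<^sup>*). A t $ i $ j)"

lemma cross_flow_integrable:
  assumes "0 \<le> a"
  shows "cross_flow integrable_on {a..b}"
  unfolding cross_flow_def case_prod_beta
  using entry_integrable_interval[OF assms]
  by (intro integrable_sum) (auto simp: absolutely_integrable_on_def)

lemma cross_flow_entry_nonneg:
  assumes "0 \<le> t" "(i, j) \<notin> (infinite_flow_edges A)\<^sup>*"
  shows "0 \<le> A t $ i $ j"
  using assms by (intro off_diagonal_nonneg) auto

text \<open>Vertices in different components are distinct and not linked, so each summand has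
  bounded integral; there are finitely many pairs.\<close>

lemma cross_flow_integral_bounded:
  obtains C where "\<And>t. 0 \<le> t \<Longrightarrow> integral {0..t} cross_flow \<le> C"
proof -
  let ?P = "-((infinite_flow_edges A)\<^sup>*)"
  have "\<forall>p. \<exists>C. p \<in> ?P \<longrightarrow> (\<forall>t\<ge>0. integral {0..t} (\<lambda>s. A s $ fst p $ snd p) \<le> C)"
  proof
    fix p
    show "\<exists>C. p \<in> ?P \<longrightarrow> (\<forall>t\<ge>0. integral {0..t} (\<lambda>s. A s $ fst p $ snd p) \<le> C)"
    proof (cases "p \<in> ?P")
      case True
      then have "fst p \<noteq> snd p" "(fst p, snd p) \<notin> infinite_flow_edges A"
        by (cases p; auto)+
      then obtain C where "\<And>t. 0 \<le> t \<Longrightarrow> integral {0..t} (\<lambda>s. A s $ fst p $ snd p) \<le> C"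
        by (rule entry_integral_bounded) blast
      then show ?thesis by blast
    qed auto
  qed
  then obtain C where C: "\<And>p t. p \<in> ?P \<Longrightarrow> 0 \<le> t \<Longrightarrow> integral {0..t} (\<lambda>s. A s $ fst p $ snd p) \<le> C p"
    by metis
  have "integral {0..t} cross_flow \<le> sum C ?P" if t: "0 \<le> t" for t
  proof -
    have "integral {0..t} cross_flow = (\<Sum>p\<in>?P. integral {0..t} (\<lambda>s. A s $ fst p $ snd p))"
      unfolding cross_flow_def case_prod_beta using entry_integrable[OF t]
      by (intro Henstock_Kurzweil_Integration.integral_sum) (auto simp: absolutely_integrable_on_def)
    also have "\<dots> \<le> sum C ?P" by (intro sum_mono C t)
    finally show ?thesis .
  qed
  then show thesis using that by blast
qed

text \<open>\<open>T\<close> is a time at which the accumulated flow is within \<open>e\<close> of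
  its finite supremum.\<close>

lemma cross_flow_tail:
  assumes "0 < e"
  obtains T where "0 \<le> T" "\<And>t. T \<le> t \<Longrightarrow> integral {T..t} cross_flow \<le> e"
proof -
  let ?F = "\<lambda>t. integral {0..t} cross_flow"
  obtain C where C: "\<And>t. 0 \<le> t \<Longrightarrow> ?F t \<le> C" using cross_flow_integral_bounded by blast
  then have bdd: "bdd_above (?F ` {0..})" by (auto intro: bdd_aboveI[of _ C])
  have "\<exists>y\<in>?F ` {0..}. Sup (?F ` {0..}) - e < y"
    using assms by (intro less_cSupD) auto
  then obtain T where T: "0 \<le> T" "Sup (?F ` {0..}) - e < ?F T" by auto
  have "integral {T..t} cross_flow \<le> e" if "T \<le> t" for t
  proof -
    have "?F t \<le> Sup (?F ` {0..})" using that T(1) by (intro cSup_upper bdd) auto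
    moreover have "?F T + integral {T..t} cross_flow = ?F t"
      using T(1) that by (intro Henstock_Kurzweil_Integration.integral_combine cross_flow_integrable) auto
    ultimately show ?thesis using T(2) by linarith
  qed
  then show thesis using that T(1) by blast
qed

end

section \<open>Vectors constant on components\<close>

lemma sym_infinite_flow_edges: "sym (infinite_flow_edges A)"
  by (auto simp: sym_def infinite_flow_edges_def add.commute)

definition class_constant :: "('n \<times> 'n) set \<Rightarrow> (real^'n) set" where
  "class_constant E = {w. \<forall>i j. (i, j) \<in> E\<^sup>* \<longrightarrow> w $ i = w $ j}"

lemma subspace_class_constant: "subspace (class_constant E)"
proof (rule subspaceI)
  show "x + y \<in> class_constant E" if "x \<in> class_constant E" "y \<in> class_constant E" for x y
    using that unfolding class_constant_def mem_Collect_eq by (metis vector_add_component)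
  show "c *\<^sub>R x \<in> class_constant E" if "x \<in> class_constant E" for c x
    using that unfolding class_constant_def mem_Collect_eq by (metis vector_scaleR_component)
qed (simp add: class_constant_def)

text \<open>The indicator vectors of the components lie in this space, and disjointness makes them
  pairwise orthogonal. They are nonzero, hence independent. Symmetry of \<open>E\<close> makes
  reachability an equivalence.\<close>

lemma card_components_le_dim_class_constant:
  fixes E :: "('n::finite \<times> 'n) set"
  assumes "sym E"
  shows "card (connected_components E) \<le> dim (class_constant E)"
proof -
  let ?K = "connected_components E"
  define f :: "'n set \<Rightarrow> real^'n" where "f V = (\<chi> i. if i \<in> V then 1 else 0)" for V
  have equiv: "equiv UNIV (E\<^sup>*)"
    using sym_rtrancl[OF assms] by (intro equivI) (auto simp: refl_rtrancl trans_rtrancl)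
  have inj: "inj_on f ?K"
    by (auto simp: inj_on_def f_def vec_eq_iff split: if_splits)
  have "orthogonal (f V) (f W)" if "V \<in> ?K" "W \<in> ?K" "f V \<noteq> f W" for V W
  proof -
    have "V \<inter> W = {}"
      using quotient_disj[OF equiv] that unfolding connected_components_def by blast
    then show ?thesis
      by (auto simp: orthogonal_def inner_vec_def f_def intro!: sum.neutral)
  qed
  then have "pairwise orthogonal (f ` ?K)" by (auto simp: pairwise_def)
  moreover have "0 \<notin> f ` ?K"
  proof
    assume "0 \<in> f ` ?K"
    then obtain V where V: "V \<in> ?K" "f V = 0" by auto
    then obtain i where "i \<in> V"
      using in_quotient_imp_non_empty[OF equiv] unfolding connected_components_def by blast
    then have "f V $ i = 1" by (simp add: f_def)
    then show False using V(2) by simp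
  qed
  ultimately have "independent (f ` ?K)" by (rule pairwise_orthogonal_independent)
  moreover have "f ` ?K \<subseteq> class_constant E"
  proof -
    have "i \<in> V \<longleftrightarrow> j \<in> V" if "V \<in> ?K" "(i, j) \<in> E\<^sup>*" for V i j
      using in_quotient_imp_closed[OF equiv] that sym_rtrancl[OF assms]
      unfolding connected_components_def by (meson symE)
    then show ?thesis by (auto simp: class_constant_def f_def)
  qed
  ultimately have "card (f ` ?K) \<le> dim (class_constant E)" by (intro independent_card_le_dim)
  then show ?thesis by (simp add: card_image[OF inj])
qed

section \<open>Null space and dimension count\<close>

context averaging_chain
begin

text \<open>Dividing by a coordinate \<open>k\<close> of greatest modulus at time \<open>T\<close>
  gives a solution that is bounded by \<open>1\<close> and equals \<open>1\<close> on the component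
  of \<open>k\<close>. It stays at least \<open>1 - 2 * (1/4)\<close> at \<open>k\<close>, which
  contradicts convergence to zero.\<close>

lemma class_constant_not_null:
  assumes "0 \<le> T" "\<And>t. T \<le> t \<Longrightarrow> integral {T..t} cross_flow \<le> 1/4"
    and w: "sol v T \<in> class_constant (infinite_flow_edges A)" and null: "(sol v \<longlongrightarrow> 0) at_top"
  shows "sol v T = 0"
proof (rule ccontr)
  let ?E = "infinite_flow_edges A"
  assume nz: "sol v T \<noteq> 0"
  let ?N = "range (\<lambda>i. \<bar>sol v T $ i\<bar>)"
  have "Max ?N \<in> ?N" by (intro Max_in) auto
  then obtain k where k: "Max ?N = \<bar>sol v T $ k\<bar>" by (rule rangeE)
  have max: "\<bar>sol v T $ i\<bar> \<le> \<bar>sol v T $ k\<bar>" for i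
    unfolding k[symmetric] by (intro Max_ge) auto
  define a where "a = sol v T $ k"
  have a: "a \<noteq> 0"
  proof
    assume "a = 0"
    then have "sol v T $ i = 0" for i using max[of i] by (simp add: a_def)
    then show False using nz by (simp add: vec_eq_iff)
  qed
  define x where "x t = (1/a) *\<^sub>R sol v t + 0 *\<^sub>R sol v t" for t
  have sol: "solution_on 0 t x" if "0 \<le> t" for t
    unfolding x_def[abs_def] using that by (intro solution_on_linear_combination solution_on_sol) auto
  define V where "V = {i. (k, i) \<in> ?E\<^sup>*}"
  have low: "1/2 \<le> x t $ k" if t: "T \<le> t" for t
  proof -
    have "1 - 2 * integral {T..t} cross_flow \<le> x t $ k"
    proof (rule solution_lower_bound_on_class[where V = V, OF sol assms(1) t])
      show "0 \<le> t" using assms(1) t by simp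
      show "\<bar>x T $ i\<bar> \<le> 1" for i
        using max[of i] a by (simp add: x_def a_def abs_mult divide_simps)
      show "x T $ i = 1" if "i \<in> V" for i
        using that w a by (auto simp: V_def class_constant_def x_def a_def)
      show "cross_flow integrable_on {T..t}" by (rule cross_flow_integrable[OF assms(1)])
      show "k \<in> V" by (simp add: V_def)
      fix i s assume i: "i \<in> V" and s: "T \<le> s" "s \<le> t"
      \<comment> \<open>A path from \<open>i\<close> to \<open>j\<close> would prolong the path from
        \<open>k\<close> to \<open>i\<close> and put \<open>j\<close> into \<open>V\<close>.\<close>
      have out: "(i, j) \<notin> ?E\<^sup>*" if "j \<in> -V" for j
        using i that by (auto simp: V_def dest: rtrancl_trans)
      have "(\<Sum>j\<in>-V. A s $ i $ j) = (\<Sum>(i, j)\<in>{i} \<times> -V. A s $ i $ j)"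
        by (simp flip: sum.cartesian_product)
      also have "\<dots> \<le> cross_flow s"
        unfolding cross_flow_def
        using out s assms(1) by (intro sum_mono2) (auto intro: cross_flow_entry_nonneg)
      finally show "(\<Sum>j\<in>-V. A s $ i $ j) \<le> cross_flow s" .
    qed
    then show ?thesis using assms(2)[OF t] by linarith
  qed
  have "((\<lambda>t. x t $ k) \<longlongrightarrow> ((1/a) *\<^sub>R 0 + 0 *\<^sub>R 0) $ k) at_top"
    unfolding x_def by (intro tendsto_intros null)
  then have "1/2 \<le> ((1/a) *\<^sub>R 0 + 0 *\<^sub>R (0::real^'n)) $ k"
    by (rule tendsto_lowerbound) (use low eventually_at_top_linorder in auto)
  then show False by simp
qed

lemma card_components_le_rank:
  "card (connected_components (infinite_flow_edges A)) \<le> chain_rank A"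
proof -
  let ?S = "class_constant (infinite_flow_edges A)" and ?N = "chain_null A 0"
  obtain T where T: "0 \<le> T" "\<And>t. T \<le> t \<Longrightarrow> integral {T..t} cross_flow \<le> 1/4"
    using cross_flow_tail[of "1/4"] by auto
  let ?L = "\<lambda>v. sol v T"
  \<comment> \<open>Linearity of the solution map is available only for \<open>t \<ge> 0\<close>, so
    each identity is used eventually along \<open>at_top\<close>.\<close>
  have N: "subspace ?N"
    unfolding chain_null_eq
  proof (rule subspaceI; unfold mem_Collect_eq)
    have "eventually (\<lambda>t. sol 0 t = 0) at_top"
      using eventually_ge_at_top[of 0] by eventually_elim (rule linear_0[OF linear_sol])
    then show "(sol 0 \<longlongrightarrow> 0) at_top" by (rule tendsto_eventually)
  next
    fix u v assume "(sol u \<longlongrightarrow> 0) at_top" "(sol v \<longlongrightarrow> 0) at_top"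
    then have "((\<lambda>t. sol u t + sol v t) \<longlongrightarrow> 0) at_top" by (rule tendsto_add_zero)
    moreover have "eventually (\<lambda>t. sol u t + sol v t = sol (u + v) t) at_top"
      using eventually_ge_at_top[of 0] by eventually_elim (rule linear_add[OF linear_sol, symmetric])
    ultimately show "(sol (u + v) \<longlongrightarrow> 0) at_top" by (rule Lim_transform_eventually)
  next
    fix c v assume "(sol v \<longlongrightarrow> 0) at_top"
    then have "((\<lambda>t. c *\<^sub>R sol v t) \<longlongrightarrow> c *\<^sub>R 0) at_top" by (intro tendsto_intros)
    then have "((\<lambda>t. c *\<^sub>R sol v t) \<longlongrightarrow> 0) at_top" by simp
    moreover have "eventually (\<lambda>t. c *\<^sub>R sol v t = sol (c *\<^sub>R v) t) at_top"
      using eventually_ge_at_top[of 0] by eventually_elim (rule linear_cmul[OF linear_sol, symmetric])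
    ultimately show "(sol (c *\<^sub>R v) \<longlongrightarrow> 0) at_top" by (rule Lim_transform_eventually)
  qed
  \<comment> \<open>The null space is moved to time \<open>T\<close>, where it can be compared with
    \<open>?S\<close>. Trivial intersection bounds the sum of both dimensions by that of the whole
    space.\<close>
  have "?S \<inter> ?L ` ?N \<subseteq> {0}"
    using class_constant_not_null[OF T] by (auto simp: chain_null_eq)
  then have "dim (?S \<inter> ?L ` ?N) = 0" by (simp add: dim_eq_0)
  then have "dim ?S + dim (?L ` ?N) = dim {x + y |x y. x \<in> ?S \<and> y \<in> ?L ` ?N}"
    using dim_sums_Int[OF subspace_class_constant[of "infinite_flow_edges A"] linear_subspace_image[OF linear_sol[OF T(1)] N]]
    by linarith
  also have "\<dots> \<le> DIM(real^'n)" by (rule dim_subset_UNIV)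
  finally have "dim ?S + dim (?L ` ?N) \<le> CARD('n)" by simp
  \<comment> \<open>Injectivity of the solution map brings the count back to the null space at time
    \<open>0\<close>.\<close>
  moreover have "dim (?L ` ?N) = dim ?N"
    using inj_sol[OF T(1)] by (intro dim_image_eq linear_sol T(1)) (auto intro: inj_on_subset)
  ultimately show ?thesis
    using card_components_le_dim_class_constant[OF sym_infinite_flow_edges, of A]
    unfolding chain_rank_def chain_nullity_def by linarith
qed

end

theorem corollary4:
  fixes A :: "real \<Rightarrow> real^'n^'n"
  assumes "continuous_time_chain A"
  shows "chain_rank A \<ge> card (connected_components (infinite_flow_edges A))"
proof -
  interpret averaging_chain A
    using assms by unfold_locales (auto simp: continuous_time_chain_def)
  show ?thesis by (rule card_components_le_rank)
qed

end
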